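(* The monoid $M_\gamma(\mathtt{a^+b^+ta^+},\mathtt{a^+tb^+a^+})$ is non-finitely based.
   Context: Monoids are regarded as semigroups with an additional nullary operation fixing the identity element. An algebra is finitely based if there is a finite subset of its identities from which all of its identities may be deduced; otherwise it is non-finitely based. Let $\mathfrak A$ be a countably infinite alphabet, $\mathfrak A^*$ the free monoid over it; $a,b,t$ are distinct letters. A letter is multiple in a word if it occurs in it at least twice; $\operatorname{mul}(\mathbf u)$ is the set of multiple letters of $\mathbf u$. Let $\tau_1$ be the congruence on $\mathfrak A^*$ generated by the relations $a=a^2$, $a\in\mathfrak A$. The congruence $\gamma$ is given by: $\mathbf u\,\gamma\,\mathbf v$ iff $\mathbf u\,\tau_1\,\mathbf v$ and $\operatorname{mul}(\mathbf u)=\operatorname{mul}(\mathbf v)$. The following are $\gamma$-classes (elements of $\mathfrak A^*/\gamma$): $\mathtt{a^+b^+ta^+}=\{a^nb^mta^k\mid n,k\ge1,\ m\ge2\}$ and $\mathtt{a^+tb^+a^+}=\{a^ntb^ma^k\mid n,k\ge1,\ m\ge2\}$. For $\gamma$-classes $\mathtt u,\mathtt v$, write $\mathtt v\le_\gamma\mathtt u$ if $\mathtt u=\mathtt p\,\mathtt v\,\mathtt s$ in $\mathfrak A^*/\gamma$ for some $\mathtt p,\mathtt s\in\mathfrak A^*/\gamma$. For a set $\mathtt W\subseteq\mathfrak A^*/\gamma$ let $\mathtt W^{\le_\gamma}=\{\mathtt v\mid \mathtt v\le_\gamma\mathtt u \text{ for some }\mathtt u\in\mathtt W\}$, and let $M_\gamma(\mathtt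 W)$ be the Rees quotient of $\mathfrak A^*/\gamma$ over the ideal $(\mathfrak A^*/\gamma)\setminus\mathtt W^{\le_\gamma}$, i.e. the monoid $\mathtt W^{\le_\gamma}\cup\{0\}$ in which the product of $\mathtt u,\mathtt v\in \mathtt W^{\le_\gamma}$ is their product in $\mathfrak A^*/\gamma$ if that lies in $\mathtt W^{\le_\gamma}$, and all other products are $0$. $M_\gamma(\mathtt w_1,\mathtt w_2)$ stands for $M_\gamma(\{\mathtt w_1,\mathtt w_2\})$. *)

theory Defs
  imports "HOL-Algebra.Group" "HOL-Library.Countable_Set"
begin

text \<open>Monoids are algebras with a binary and a nullary operation, so identities are pairs of terms
  over these two operations, with variables from the countably infinite set of naturals.
  Associativity and the unit laws are ordinary identities here; they are not built into
  deduction, which follows Birkhoff's rules of equational logic.\<close>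

datatype mterm = Var nat | Unit | Prod mterm mterm

primrec mterm_eval :: "('m, 'x) monoid_scheme \<Rightarrow> (nat \<Rightarrow> 'm) \<Rightarrow> mterm \<Rightarrow> 'm" where
  "mterm_eval M \<phi> (Var x) = \<phi> x"
| "mterm_eval M \<phi> Unit = \<one>\<^bsub>M\<^esub>"
| "mterm_eval M \<phi> (Prod p q) = mterm_eval M \<phi> p \<otimes>\<^bsub>M\<^esub> mterm_eval M \<phi> q"

primrec mterm_subst :: "(nat \<Rightarrow> mterm) \<Rightarrow> mterm \<Rightarrow> mterm" where
  "mterm_subst \<sigma> (Var x) = \<sigma> x"
| "mterm_subst \<sigma> Unit = Unit"
| "mterm_subst \<sigma> (Prod p q) = Prod (mterm_subst \<sigma> p) (mterm_subst \<sigma> q)"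

definition identities :: "('m, 'x) monoid_scheme \<Rightarrow> (mterm \<times> mterm) set" where
  "identities M =
    {(p, q). \<forall>\<phi>. (\<forall>x. \<phi> x \<in> carrier M) \<longrightarrow> mterm_eval M \<phi> p = mterm_eval M \<phi> q}"

inductive deducible :: "(mterm \<times> mterm) set \<Rightarrow> mterm \<Rightarrow> mterm \<Rightarrow> bool"
  for E :: "(mterm \<times> mterm) set" where
  ax: "(p, q) \<in> E \<Longrightarrow> deducible E p q"
| refl: "deducible E p p"
| sym: "deducible E p q \<Longrightarrow> deducible E q p"
| trans: "deducible E p q \<Longrightarrow> deducible E q r \<Longrightarrow> deducible E p r"
| cong: "deducible E p q \<Longrightarrow> deducible E p' q' \<Longrightarrow> deducible E (Prod p p') (Prod q q')"
| subst: "deducible E p q \<Longrightarrow> deducible E (mterm_subst \<sigma> p) (mterm_subst \<sigma> q)"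

definition finitely_based :: "('m, 'x) monoid_scheme \<Rightarrow> bool" where
  "finitely_based M \<longleftrightarrow>
    (\<exists>E. finite E \<and> E \<subseteq> identities M \<and> (\<forall>(p, q) \<in> identities M. deducible E p q))"

text \<open>The free monoid over the alphabet \<open>'a\<close> is \<open>'a list\<close>. The congruence \<open>\<tau>\<^sub>1\<close> is generated by \<open>x = x\<^sup>2\<close>
  for letters \<open>x\<close> only, not for all words.\<close>

inductive tau1 :: "'a list \<Rightarrow> 'a list \<Rightarrow> bool" where
  gen: "tau1 [a] [a, a]"
| refl: "tau1 u u"
| sym: "tau1 u v \<Longrightarrow> tau1 v u"
| trans: "tau1 u v \<Longrightarrow> tau1 v w \<Longrightarrow> tau1 u w"
| cong: "tau1 u v \<Longrightarrow> tau1 u' v' \<Longrightarrow> tau1 (u @ u') (v @ v')"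

definition mul :: "'a list \<Rightarrow> 'a set" where
  "mul u = {x. count_list u x \<ge> 2}"

definition gamma :: "('a list \<times> 'a list) set" where
  "gamma = {(u, v). tau1 u v \<and> mul u = mul v}"

text \<open>The class of \<open>u @ v\<close> does not depend on the representatives \<open>u\<close>, \<open>v\<close>, so the union in the
  product below is over equal sets; see \<open>gamma_quot_mult\<close>.\<close>

definition gamma_quot :: "'a list set monoid" where
  "gamma_quot =
    \<lparr>carrier = UNIV // gamma,
     mult = (\<lambda>U V. \<Union>u\<in>U. \<Union>v\<in>V. gamma `` {u @ v}),
     one = gamma `` {[]}\<rparr>"

lemma equiv_gamma: "equiv UNIV gamma"
  unfolding gamma_def
  by (rule equivI) (auto intro!: refl_onI symI transI intro: tau1.refl dest: tau1.sym tau1.trans)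

lemma tau1_set: "tau1 u v \<Longrightarrow> set u = set v"
  by (induction rule: tau1.induct) auto

lemma mul_append: "mul (u @ v) = mul u \<union> mul v \<union> (set u \<inter> set v)"
proof -
  have "x \<in> set w \<longleftrightarrow> count_list w x \<ge> 1" for x :: 'a and w
    by (metis count_list_0_iff less_one not_le)
  then show ?thesis
    by (auto simp: mul_def)
qed

lemma gamma_append:
  "(u, v) \<in> gamma \<Longrightarrow> (u', v') \<in> gamma \<Longrightarrow> (u @ u', v @ v') \<in> gamma"
  by (auto simp: gamma_def mul_append dest: tau1_set intro: tau1.cong)

lemma gamma_quot_mult: "gamma `` {u} \<otimes>\<^bsub>gamma_quot\<^esub> gamma `` {v} = gamma `` {u @ v}"
proof -
  have eq: "gamma `` {u' @ v'} = gamma `` {u @ v}"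
    if "u' \<in> gamma `` {u}" "v' \<in> gamma `` {v}" for u' v'
    using equiv_class_eq[OF equiv_gamma gamma_append] that by blast
  have "(\<Union>u'\<in>gamma `` {u}. \<Union>v'\<in>gamma `` {v}. gamma `` {u' @ v'}) =
        (\<Union>u'\<in>gamma `` {u}. \<Union>v'\<in>gamma `` {v}. gamma `` {u @ v})"
    by (intro SUP_cong HOL.refl eq)
  also have "\<dots> = gamma `` {u @ v}"
    using equiv_class_self[OF equiv_gamma UNIV_I] by blast
  finally show ?thesis
    by (simp add: gamma_quot_def)
qed

definition le_gamma :: "'a list set \<Rightarrow> 'a list set \<Rightarrow> bool"  (infix \<open>\<le>\<^sub>\<gamma>\<close> 50) where
  "V \<le>\<^sub>\<gamma> U \<longleftrightarrow>
    (\<exists>P \<in> carrier gamma_quot. \<exists>S \<in> carrier gamma_quot.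
      U = P \<otimes>\<^bsub>gamma_quot\<^esub> V \<otimes>\<^bsub>gamma_quot\<^esub> S)"

definition down_gamma :: "'a list set set \<Rightarrow> 'a list set set" where
  "down_gamma W = {V \<in> carrier gamma_quot. \<exists>U \<in> W. V \<le>\<^sub>\<gamma> U}"

text \<open>\<open>None\<close> is the zero of the Rees quotient.\<close>

definition M_gamma :: "'a list set set \<Rightarrow> 'a list set option monoid" where
  "M_gamma W =
    \<lparr>carrier = insert None (Some ` down_gamma W),
     mult = (\<lambda>x y. case (x, y) of
        (Some U, Some V) \<Rightarrow>
          if U \<otimes>\<^bsub>gamma_quot\<^esub> V \<in> down_gamma W then Some (U \<otimes>\<^bsub>gamma_quot\<^esub> V) else None
      | _ \<Rightarrow> None),
     one = Some \<one>\<^bsub>gamma_quot\<^esub>\<rparr>"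

text \<open>The classes \<open>a\<^sup>+b\<^sup>+ta\<^sup>+\<close> and \<open>a\<^sup>+tb\<^sup>+a\<^sup>+\<close>; as \<open>b\<close> has to be multiple, its exponent is at least 2.\<close>

definition class_abta :: "'a \<Rightarrow> 'a \<Rightarrow> 'a \<Rightarrow> 'a list set" where
  "class_abta a b t =
    {replicate n a @ replicate m b @ [t] @ replicate k a | n m k. n \<ge> 1 \<and> k \<ge> 1 \<and> m \<ge> 2}"

definition class_atba :: "'a \<Rightarrow> 'a \<Rightarrow> 'a \<Rightarrow> 'a list set" where
  "class_atba a b t =
    {replicate n a @ [t] @ replicate m b @ replicate k a | n m k. n \<ge> 1 \<and> k \<ge> 1 \<and> m \<ge> 2}"

end

theory Submission
  imports Defs "HOL-Library.Sublist"
begin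

text \<open>For every \<open>n\<close> the monoid satisfies
  \<open>x y t y z\<^sub>1\<^sup>2 \<dots> z\<^sub>n\<^sup>2 x = y x t y z\<^sub>1\<^sup>2 \<dots> z\<^sub>n\<^sup>2 x\<close>: a nonzero value of either side forces \<open>x\<close> and \<open>y\<close> to
  be powers of the same letter. Identities in fewer than \<open>n\<close> letters cannot prove it, because they
  preserve the property that deleting all letters except \<open>x\<close> and \<open>y\<close> leaves a word in
  \<open>x\<^sup>+y\<^sup>+x\<^sup>+\<close>. Indeed, when \<open>p = q\<close> is applied to a word equal to the left-hand side, the order of
  the \<open>z\<^sub>i\<close> is rigid, so no two of them lie in the image of one multiple letter of \<open>p\<close>. Hence some \<open>z\<^sub>i\<close>
  lies in the image of a linear letter. Putting the letter \<open>t\<close> of the monoid at this place and mapping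
  \<open>x\<close> to \<open>a\<close> and \<open>y\<close> to \<open>b\<close> sends \<open>p\<close> into the class \<open>a\<^sup>+b\<^sup>+ta\<^sup>+\<close>, which the image of \<open>q\<close> cannot leave.\<close>

section \<open>Words up to repetition of adjacent letters\<close>

text \<open>An embedding of a word without equal neighbours uses at most one letter of each maximal
  constant block, so it survives the collapse of the blocks.\<close>

lemma distinct_adj_subseq_remdups_adj:
  "subseq l w \<Longrightarrow> distinct_adj l \<Longrightarrow> subseq l (remdups_adj w)"
proof (induction w arbitrary: l)
  case (Cons x w)
  show ?case
  proof (cases "subseq l w")
    case True
    then have "subseq l (remdups_adj w)" using Cons by blast
    then show ?thesis
      by (auto simp: remdups_adj_Cons split: list.splits)
  next
    case False
    then obtain l' where l: "l = x # l'" and "subseq l' w"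
      using Cons.prems(1) by (cases l) (auto split: if_splits)
    then have *: "subseq l' (remdups_adj w)" and "l' = [] \<or> hd l' \<noteq> x"
      using Cons by (auto simp: distinct_adj_Cons)
    then show ?thesis
      unfolding l by (cases l') (auto simp: remdups_adj_Cons split: list.splits if_splits)
  qed
qed auto

lemma remdups_adj_append_cong:
  assumes "remdups_adj u = remdups_adj u'" "remdups_adj v = remdups_adj v'"
  shows "remdups_adj (u @ v) = remdups_adj (u' @ v')"
proof -
  have *: "remdups_adj (x @ z) = remdups_adj (y @ z)"
    if "remdups_adj x = remdups_adj y" for x y z :: "'a list"
  proof (cases "x = []")
    case False
    moreover from this that have "y \<noteq> []" by auto
    moreover have "last x = last y" using that by (metis last_remdups_adj)
    ultimately show ?thesis using that by (simp add: remdups_adj_append'')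
  qed (use that in \<open>metis remdups_adj_Nil_iff\<close>)
  \<comment> \<open>Reversal reduces changing the right factor to changing the left one.\<close>
  have "remdups_adj (rev v @ rev u') = remdups_adj (rev v' @ rev u')"
    using assms by (intro *) simp
  then have "rev (remdups_adj (rev (u' @ v))) = rev (remdups_adj (rev (u' @ v')))" by simp
  then show ?thesis using *[OF assms(1), of v] by (simp only: remdups_adj_rev rev_rev_ident)
qed

lemma remdups_adj_replicate_append:
  assumes "n \<ge> 1" "v = [] \<or> hd v \<noteq> x"
  shows "remdups_adj (replicate n x @ v) = x # remdups_adj v"
proof (cases "v = []")
  case False
  then show ?thesis using assms
    by (subst remdups_adj_append') (auto simp: remdups_adj_replicate)
qed (use assms in \<open>simp add: remdups_adj_replicate\<close>)

lemma remdups_adj_eq_Cons: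
  assumes "remdups_adj w = x # l"
  shows "\<exists>n w'. n \<ge> 1 \<and> w = replicate n x @ w' \<and> remdups_adj w' = l"
  using assms
proof (induction w rule: remdups_adj.induct)
  case (2 y)
  then show ?case by (intro exI[of _ 1] exI[of _ "[]"]) auto
next
  case (3 y z w)
  show ?case
  proof (cases "y = z")
    case True
    with 3 obtain n w' where "n \<ge> 1" "z # w = replicate n x @ w'" "remdups_adj w' = l" 
      by auto
    moreover have "y = x" using 3 True by (metis hd_remdups_adj list.sel(1))
    ultimately show ?thesis by (intro exI[of _ "Suc n"] exI[of _ w']) auto
  next
    case False
    with 3 show ?thesis by (intro exI[of _ 1] exI[of _ "z # w"]) auto
  qed
qed auto

lemma subseq_concat_map:
  "subseq u v \<Longrightarrow> subseq (concat (map r u)) (concat (map r v))"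
  by (induction rule: list_emb.induct) (auto intro: list_emb_append_mono list_emb_append2)

lemma last_append_in_set: "v \<noteq> [] \<Longrightarrow> last (u @ v) \<in> set v"
  by simp

lemma concat_map_concat_map:
  "concat (map f (concat (map g w))) = concat (map (\<lambda>c. concat (map f (g c))) w)"
  by (induction w) auto

lemma filter_concat_map: "filter P (concat (map f w)) = concat (map (\<lambda>c. filter P (f c)) w)"
  by (induction w) auto

lemma concat_map_Nil: "(\<And>x. x \<in> set w \<Longrightarrow> f x = []) \<Longrightarrow> concat (map f w) = []"
  by (induction w) auto

section \<open>Normal forms for \<open>tau1\<close> and the two classes\<close>

text \<open>\<open>remdups_adj\<close> is a normal form: the generating relations and concatenation
  respect it, and every word is \<open>tau1\<close>-related to its own collapse.\<close>

lemma tau1_iff_remdups_adj: "tau1 u v \<longleftrightarrow> remdups_adj u = remdups_adj v"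
proof
  show "tau1 u v \<Longrightarrow> remdups_adj u = remdups_adj v"
  proof (induction rule: tau1.induct)
    case (cong u v u' v')
    then show ?case by (metis remdups_adj_append_cong)
  qed auto
next
  have *: "tau1 w (remdups_adj w)" for w :: "'a list"
  proof (induction w rule: remdups_adj.induct)
    case (3 x y w)
    show ?case
    proof (cases "x = y")
      case True
      have "tau1 ([x, x] @ w) ([x] @ w)"
        by (intro tau1.cong tau1.sym[OF tau1.gen] tau1.refl)
      then show ?thesis using 3 True by (auto intro: tau1.trans)
    next
      case False
      then have "tau1 ([x] @ (y # w)) ([x] @ remdups_adj (y # w))"
        using 3 by (intro tau1.cong tau1.refl) auto
      then show ?thesis using False by simp
    qed
  qed (auto intro: tau1.refl)
  show "remdups_adj u = remdups_adj v \<Longrightarrow> tau1 u v"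
    by (metis * tau1.sym tau1.trans)
qed

text \<open>Deleting letters is a homomorphism that sends each generating relation of
  \<open>tau1\<close> to itself or to a trivial one.\<close>

lemma remdups_adj_filter_cong:
  assumes "remdups_adj u = remdups_adj v"
  shows "remdups_adj (filter P u) = remdups_adj (filter P v)"
proof -
  have "tau1 u v \<Longrightarrow> tau1 (filter P u) (filter P v)"
    by (induction rule: tau1.induct) (auto intro: tau1.intros)
  then show ?thesis using assms by (simp add: tau1_iff_remdups_adj)
qed

lemma gamma_iff: "(u, v) \<in> gamma \<longleftrightarrow> remdups_adj u = remdups_adj v \<and> mul u = mul v"
  by (simp add: gamma_def tau1_iff_remdups_adj)

lemma gamma_class_eq_iff: "gamma `` {u} = gamma `` {v} \<longleftrightarrow> (u, v) \<in> gamma"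
  using eq_equiv_class_iff[OF equiv_gamma] by blast

lemma mul_replicate: "mul (replicate n x) = (if n \<ge> 2 then {x} else {})"
proof -
  have "count_list (replicate n x) y = (if x = y then n else 0)" for y
    by (induction n) auto
  then show ?thesis by (auto simp: mul_def split: if_splits)
qed

lemma mul_Cons: "mul (x # w) = mul w \<union> (if x \<in> set w then {x} else {})"
  using mul_append[of "[x]" w] by (auto simp: mul_def)

lemma mul_Nil: "mul [] = {}"
  by (simp add: mul_def)

lemma mul_subset_set: "mul w \<subseteq> set w"
  by (induction w) (auto simp: mul_Nil mul_Cons)

lemma class_abta_iff:
  assumes "distinct [a, b, t]"
  shows "w \<in> class_abta a b t \<longleftrightarrow> remdups_adj w = [a, b, t, a] \<and> mul w = {a, b}"
proof
  assume "w \<in> class_abta a b t"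
  then obtain n m k where w: "w = replicate n a @ replicate m b @ [t] @ replicate k a"
    and "n \<ge> 1" "k \<ge> 1" "m \<ge> 2" by (auto simp: class_abta_def)
  moreover have "[t] = replicate 1 t" by simp
  ultimately show "remdups_adj w = [a, b, t, a] \<and> mul w = {a, b}"
    using assms unfolding w
    by (auto simp: remdups_adj_replicate_append remdups_adj_replicate mul_append mul_replicate
        hd_append simp del: replicate.simps)
next
  assume *: "remdups_adj w = [a, b, t, a] \<and> mul w = {a, b}"
  obtain n m j k where w: "w = replicate n a @ replicate m b @ replicate j t @ replicate k a"
    and *: "n \<ge> 1" "m \<ge> 1" "j \<ge> 1" "k \<ge> 1" and mul: "mul w = {a, b}"
    using * by (metis remdups_adj_eq_Cons append_Nil2 remdups_adj_Nil_iff)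
  \<comment> \<open>The collapse only fixes the order of the blocks. Multiplicity of
    \<open>b\<close> bounds its block from below, and \<open>t\<close> not being multiple makes its
    block a single letter.\<close>
  have "m \<ge> 2" "\<not> j \<ge> 2"
    using mul assms unfolding w
    by (auto simp: mul_append mul_replicate split: if_splits)
  moreover from this * have "j = 1" by auto
  ultimately show "w \<in> class_abta a b t"
    unfolding class_abta_def using w * by auto
qed

lemma class_atba_iff:
  assumes "distinct [a, b, t]"
  shows "w \<in> class_atba a b t \<longleftrightarrow> remdups_adj w = [a, t, b, a] \<and> mul w = {a, b}"
proof
  assume "w \<in> class_atba a b t"
  then obtain n m k where w: "w = replicate n a @ [t] @ replicate m b @ replicate k a"
    and "n \<ge> 1" "k \<ge> 1" "m \<ge> 2" by (auto simp: class_atba_def)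
  moreover have "[t] = replicate 1 t" by simp
  ultimately show "remdups_adj w = [a, t, b, a] \<and> mul w = {a, b}"
    using assms unfolding w
    by (auto simp: remdups_adj_replicate_append remdups_adj_replicate mul_append mul_replicate
        hd_append simp del: replicate.simps)
next
  assume *: "remdups_adj w = [a, t, b, a] \<and> mul w = {a, b}"
  obtain n m j k where w: "w = replicate n a @ replicate j t @ replicate m b @ replicate k a"
    and *: "n \<ge> 1" "m \<ge> 1" "j \<ge> 1" "k \<ge> 1" and mul: "mul w = {a, b}"
    using * by (metis remdups_adj_eq_Cons append_Nil2 remdups_adj_Nil_iff)
  have "m \<ge> 2" "\<not> j \<ge> 2"
    using mul assms unfolding w
    by (auto simp: mul_append mul_replicate split: if_splits)
  moreover from this * have "j = 1" by auto
  ultimately show "w \<in> class_atba a b t"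
    unfolding class_atba_def using w * by auto
qed

lemma class_abta_eq_gamma_class:
  "distinct [a, b, t] \<Longrightarrow> w \<in> class_abta a b t \<Longrightarrow> gamma `` {w} = class_abta a b t"
  by (auto simp: class_abta_iff gamma_iff)

lemma class_atba_eq_gamma_class:
  "distinct [a, b, t] \<Longrightarrow> w \<in> class_atba a b t \<Longrightarrow> gamma `` {w} = class_atba a b t"
  by (auto simp: class_atba_iff gamma_iff)

section \<open>Identities of Rees quotients as word identities\<close>

lemma gamma_class_in_down_gamma_iff:
  "gamma `` {w} \<in> down_gamma W \<longleftrightarrow> (\<exists>p s. gamma `` {p @ w @ s} \<in> W)"
proof -
  have carrier: "carrier gamma_quot = range (\<lambda>u. gamma `` {u})"
    by (auto simp: gamma_quot_def quotient_def)
  show ?thesis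
    by (auto simp: down_gamma_def le_gamma_def carrier gamma_quot_mult)
qed

lemma down_gamma_elem: "V \<in> down_gamma W \<Longrightarrow> \<exists>w. V = gamma `` {w}"
  by (auto simp: down_gamma_def gamma_quot_def quotient_def)

text \<open>Nonzero products have nonzero factors; this makes \<open>rees_class\<close>
  multiplicative.\<close>

lemma gamma_class_append_in_down_gammaD:
  assumes "gamma `` {u @ v} \<in> down_gamma W"
  shows "gamma `` {u} \<in> down_gamma W" "gamma `` {v} \<in> down_gamma W"
proof -
  obtain p s where *: "gamma `` {p @ (u @ v) @ s} \<in> W"
    using assms gamma_class_in_down_gamma_iff by metis
  have "gamma `` {p @ u @ (v @ s)} \<in> W" "gamma `` {(p @ u) @ v @ s} \<in> W"
    using * by simp_all
  then show "gamma `` {u} \<in> down_gamma W" "gamma `` {v} \<in> down_gamma W"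
    using gamma_class_in_down_gamma_iff by metis+
qed

text \<open>The canonical map from the free monoid to the Rees quotient.\<close>

definition rees_class :: "'a list set set \<Rightarrow> 'a list \<Rightarrow> 'a list set option" where
  "rees_class W w = (if gamma `` {w} \<in> down_gamma W then Some (gamma `` {w}) else None)"

lemma rees_class_append:
  "rees_class W (u @ v) = rees_class W u \<otimes>\<^bsub>M_gamma W\<^esub> rees_class W v"
  using gamma_class_append_in_down_gammaD[of u v W]
  by (auto simp: rees_class_def M_gamma_def gamma_quot_mult)

lemma rees_class_eqD:
  assumes "rees_class W u = rees_class W v" "gamma `` {u} \<in> down_gamma W"
  shows "(u, v) \<in> gamma"
  using assms by (auto simp: rees_class_def gamma_class_eq_iff[symmetric] split: if_splits)

primrec mterm_word :: "mterm \<Rightarrow> nat list" where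
  "mterm_word (Var x) = [x]"
| "mterm_word Unit = []"
| "mterm_word (Prod p q) = mterm_word p @ mterm_word q"

lemma mterm_word_subst:
  "mterm_word (mterm_subst \<sigma> p) = concat (map (\<lambda>x. mterm_word (\<sigma> x)) (mterm_word p))"
  by (induction p) auto

lemma ex_mterm_word: "\<exists>p. mterm_word p = w"
proof (induction w)
  case Nil
  show ?case by (rule exI[of _ Unit]) simp
next
  case (Cons x w)
  then obtain p where "mterm_word p = w" ..
  then show ?case by (intro exI[of _ "Prod (Var x) p"]) simp
qed

lemma mterm_eval_rees_class:
  assumes "gamma `` {[]} \<in> down_gamma W"
  shows "mterm_eval (M_gamma W) (\<lambda>x. rees_class W (r x)) p =
    rees_class W (concat (map r (mterm_word p)))"
proof (induction p)
  case Unit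
  then show ?case using assms by (simp add: rees_class_def M_gamma_def gamma_quot_def)
qed (auto simp: rees_class_append)

definition word_identity :: "'a list set set \<Rightarrow> nat list \<Rightarrow> nat list \<Rightarrow> bool" where
  "word_identity W u v \<longleftrightarrow>
    (\<forall>r. rees_class W (concat (map r u)) = rees_class W (concat (map r v)))"

text \<open>By \<open>one\<close>, the empty word represents the unit; by \<open>zero\<close>, some
  word represents \<open>None\<close>. Hence every assignment in the monoid lifts to a substitution
  of words.\<close>

lemma identities_iff_word_identity:
  assumes one: "gamma `` {[]} \<in> down_gamma W" and zero: "gamma `` {z} \<notin> down_gamma W"
  shows "(p, q) \<in> identities (M_gamma W) \<longleftrightarrow> word_identity W (mterm_word p) (mterm_word q)"
proof
  assume "(p, q) \<in> identities (M_gamma W)"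
  moreover have "rees_class W w \<in> carrier (M_gamma W)" for w
    by (simp add: rees_class_def M_gamma_def)
  ultimately show "word_identity W (mterm_word p) (mterm_word q)"
    unfolding word_identity_def mterm_eval_rees_class[OF one, symmetric] identities_def by auto
next
  assume *: "word_identity W (mterm_word p) (mterm_word q)"
  have surj: "\<exists>w. y = rees_class W w" if y: "y \<in> carrier (M_gamma W)" for y
  proof (cases y)
    case None
    then show ?thesis using zero by (intro exI[of _ z]) (simp add: rees_class_def)
  next
    case (Some V)
    then have V: "V \<in> down_gamma W" using y by (auto simp: M_gamma_def)
    then obtain w where "V = gamma `` {w}" using down_gamma_elem by blast
    then show ?thesis using Some V by (intro exI[of _ w]) (simp add: rees_class_def)
  qed
  show "(p, q) \<in> identities (M_gamma W)"
    unfolding identities_def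
  proof safe
    fix \<phi> :: "nat \<Rightarrow> _" assume "\<forall>x. \<phi> x \<in> carrier (M_gamma W)"
    then have "\<forall>x. \<exists>w. \<phi> x = rees_class W w" using surj by blast
    from choice[OF this] obtain r where "\<forall>x. \<phi> x = rees_class W (r x)" ..
    then have "\<phi> = (\<lambda>x. rees_class W (r x))" by (simp add: fun_eq_iff)
    then show "mterm_eval (M_gamma W) \<phi> p = mterm_eval (M_gamma W) \<phi> q"
      using * by (simp add: mterm_eval_rees_class[OF one] word_identity_def)
  qed
qed

lemma word_identity_sym: "word_identity W u v \<Longrightarrow> word_identity W v u"
  by (simp add: word_identity_def)

lemma word_identity_trans:
  "word_identity W u v \<Longrightarrow> word_identity W v w \<Longrightarrow> word_identity W u w"
  by (simp add: word_identity_def)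

lemma word_identity_context:
  "word_identity W u v \<Longrightarrow> word_identity W (p @ u @ s) (p @ v @ s)"
  by (simp add: word_identity_def rees_class_append)

lemma word_identity_subst:
  "word_identity W u v \<Longrightarrow> word_identity W (concat (map \<sigma> u)) (concat (map \<sigma> v))"
  by (simp add: word_identity_def concat_map_concat_map)

text \<open>Equality of nonzero values in the Rees quotient is equality of
  \<open>gamma\<close>-classes. Every restriction on words equal to a given one is obtained from
  this.\<close>

lemma word_identityD:
  assumes "word_identity W u v" "gamma `` {concat (map r u)} \<in> down_gamma W"
  shows "remdups_adj (concat (map r v)) = remdups_adj (concat (map r u))"
    and "mul (concat (map r v)) = mul (concat (map r u))"
    and "set (concat (map r v)) = set (concat (map r u))"
proof -
  have *: "(concat (map r u), concat (map r v)) \<in> gamma"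
    using assms rees_class_eqD by (auto simp: word_identity_def)
  then show "remdups_adj (concat (map r v)) = remdups_adj (concat (map r u))"
    and "mul (concat (map r v)) = mul (concat (map r u))"
    by (auto simp: gamma_iff)
  then show "set (concat (map r v)) = set (concat (map r u))"
    by (metis remdups_adj_set)
qed

text \<open>Contexts and substitutions are quantified for the sake of the induction: in
  \<open>cong\<close> the context absorbs the other factor, and in \<open>subst\<close> the
  substitutions are composed.\<close>

lemma deducible_invariant:
  assumes "deducible E p q"
    and "\<And>p q \<sigma> u v. (p, q) \<in> E \<Longrightarrow>
      J (u @ concat (map \<sigma> (mterm_word p)) @ v) = J (u @ concat (map \<sigma> (mterm_word q)) @ v)"
  shows "J (u @ concat (map \<sigma> (mterm_word p)) @ v) = J (u @ concat (map \<sigma> (mterm_word q)) @ v)"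
  using assms(1)
proof (induction arbitrary: \<sigma> u v rule: deducible.induct)
  case (cong p q p' q')
  show ?case
    using cong.IH(1)[of u \<sigma> "concat (map \<sigma> (mterm_word p')) @ v"]
      cong.IH(2)[of "u @ concat (map \<sigma> (mterm_word q))" \<sigma> v] by simp
next
  case (subst p q \<tau>)
  then show ?case by (simp add: mterm_word_subst concat_map_concat_map)
qed (auto intro: assms(2))

section \<open>The identities without a finite basis\<close>

locale three_letters =
  fixes a b t :: 'a
  assumes distinct: "distinct [a, b, t]"
begin

abbreviation "W \<equiv> {class_abta a b t, class_atba a b t}"

lemma in_classes_iff:
  "w \<in> \<Union> W \<longleftrightarrow> remdups_adj w \<in> {[a, b, t, a], [a, t, b, a]} \<and> mul w = {a, b}"
  using distinct by (auto simp: class_abta_iff class_atba_iff)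

lemma in_classes:
  "[a, b, b, t, a] \<in> \<Union> W" "[a, a, b, b, t, a] \<in> \<Union> W" "[a, t, b, b, a] \<in> \<Union> W"
  unfolding in_classes_iff using distinct by (auto simp: mul_Cons mul_Nil)

lemma class_subseqD:
  assumes "w \<in> \<Union> W" "subseq l w" "distinct_adj l"
  shows "subseq l [a, b, t, a] \<or> subseq l [a, t, b, a]"
  using distinct_adj_subseq_remdups_adj[OF assms(2,3)] assms(1) unfolding in_classes_iff by auto

lemma down_iff: "gamma `` {w} \<in> down_gamma W \<longleftrightarrow> (\<exists>p s. p @ w @ s \<in> \<Union> W)"
proof -
  have "gamma `` {v} \<in> W \<longleftrightarrow> v \<in> \<Union> W" for v
    using class_abta_eq_gamma_class[OF distinct] class_atba_eq_gamma_class[OF distinct]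
      equiv_class_self[OF equiv_gamma UNIV_I, of v] by auto
  then show ?thesis by (simp add: gamma_class_in_down_gamma_iff)
qed

lemma word_identity_imageD:
  assumes "word_identity W u v" "concat (map r u) = w" "p @ w @ s \<in> \<Union> W"
  shows "remdups_adj (concat (map r v)) = remdups_adj w"
    and "mul (concat (map r v)) = mul w"
    and "set (concat (map r v)) = set w"
  using word_identityD[OF assms(1), of r] assms(2,3) down_iff by blast+

lemma identities_iff: "(p, q) \<in> identities (M_gamma W) \<longleftrightarrow> word_identity W (mterm_word p) (mterm_word q)"
proof (rule identities_iff_word_identity)
  have "[a, b, b, t, a] @ [] @ [] \<in> \<Union> W" using in_classes by simp
  then show "gamma `` {[]} \<in> down_gamma W" unfolding down_iff by blast
  show "gamma `` {[t, t]} \<notin> down_gamma W"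
    unfolding down_iff using distinct
    by (auto simp: class_abta_iff class_atba_iff mul_append mul_Cons)
qed

text \<open>The letters \<open>x\<close>, \<open>y\<close>, \<open>t\<close>, \<open>z\<^sub>i\<close> are the numbers \<open>0\<close>, \<open>1\<close>, \<open>2\<close>, \<open>i + 3\<close>.\<close>

definition squares :: "nat \<Rightarrow> nat list" where
  "squares n = concat (map (\<lambda>i. [i + 3, i + 3]) [0..<n])"

definition lhs :: "nat \<Rightarrow> nat list" where "lhs n = [0, 1, 2, 1] @ squares n @ [0]"
definition rhs :: "nat \<Rightarrow> nat list" where "rhs n = [1, 0, 2, 1] @ squares n @ [0]"

lemma set_squares_image: "set (concat (map r (squares n))) \<subseteq> mul (concat (map r (squares n)))"
  by (induction n) (auto simp: squares_def mul_append)

lemma squares_image_Nil: "(\<And>i. r (i + 3) = []) \<Longrightarrow> concat (map r (squares n)) = []"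
  unfolding squares_def by (simp add: concat_map_concat_map)

lemma squares_image_single:
  assumes "i < n" "\<And>j. j \<noteq> i \<Longrightarrow> r (j + 3) = []"
  shows "concat (map r (squares n)) = r (i + 3) @ r (i + 3)"
  using assms by (induction n) (auto simp: squares_def less_Suc_eq concat_map_concat_map intro!: concat_map_Nil)

lemma squares_image_pair:
  assumes "i < k" "k < n" "\<And>j. j \<noteq> i \<Longrightarrow> j \<noteq> k \<Longrightarrow> r (j + 3) = []"
  shows "concat (map r (squares n)) = r (i + 3) @ r (i + 3) @ r (k + 3) @ r (k + 3)"
  using assms(2)
proof (induction n)
  case (Suc n)
  show ?case
  proof (cases "k = n")
    case True
    \<comment> \<open>For \<open>k = n\<close> the letter \<open>k + 3\<close> is absent from
      \<open>squares n\<close>, so erasing it changes nothing and leaves a single surviving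
      square.\<close>
    have "concat (map (r(k + 3 := [])) (squares n)) = r (i + 3) @ r (i + 3)"
      using assms True by (subst squares_image_single) auto
    moreover have "map (r(k + 3 := [])) (squares n) = map r (squares n)"
      by (rule map_cong) (auto simp: squares_def True)
    ultimately show ?thesis using True by (simp add: squares_def)
  qed (use Suc assms in \<open>simp add: squares_def\<close>)
qed simp

section \<open>Validity of the identities\<close>

text \<open>Here \<open>u\<close>, \<open>v\<close>, \<open>w\<close>, \<open>e\<close> stand for
  the images of x, y, t and the squares. In a word \<open>L\<close> of the classes with such a
  factor, all letters of \<open>u\<close>, \<open>v\<close>, \<open>e\<close> are multiple, hence
  different from \<open>t\<close>. So \<open>c\<close> and \<open>d\<close> are \<open>a\<close> and
  \<open>b\<close> in some order, and \<open>t\<close> lies in \<open>p\<close>, \<open>w\<close> or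
  \<open>s\<close>. One letter from each relevant factor gives a subsequence whose collapse has five
  letters, or has four and begins or ends with \<open>t\<close>; neither fits into
  \<open>[a, b, t, a]\<close> or \<open>[a, t, b, a]\<close>.\<close>

lemma not_down_if_crossing:
  assumes "c \<in> set u" "d \<in> set v" "c \<noteq> d"
    and e: "set e \<subseteq> mul e"
  shows "gamma `` {u @ v @ w @ v @ e @ u} \<notin> down_gamma W"
    and "gamma `` {v @ u @ w @ v @ e @ u} \<notin> down_gamma W"
proof -
  have *: False if L: "L = p @ m @ w @ v @ e @ u @ s" "L \<in> \<Union> W" and m: "m = u @ v \<or> m = v @ u" for L p m s
  proof -
    have "remdups_adj L \<in> {[a, b, t, a], [a, t, b, a]}" and mul: "mul L = {a, b}"
      using L(2) unfolding in_classes_iff by blast+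
    moreover have "set l = {a, b, t}" if "l \<in> {[a, b, t, a], [a, t, b, a]}" for l
      using that by auto
    ultimately have set: "set L = {a, b, t}" using remdups_adj_set by metis
    have sub_mul: "set u \<union> set v \<union> set e \<subseteq> mul L"
      using m e unfolding L(1) by (auto simp: mul_append)
    have "c \<in> mul L" "d \<in> mul L" using sub_mul assms(1,2) by blast+
    then have cd: "{c, d} = {a, b}" using \<open>c \<noteq> d\<close> mul by auto
    have "t \<in> set L" using set by simp
    then have "t \<in> set p \<union> set w \<union> set s \<union> (set u \<union> set v \<union> set e)"
      using m unfolding L(1) by auto
    moreover have "t \<notin> mul L" using mul distinct by auto
    ultimately have "t \<in> set p \<union> set w \<union> set s" using sub_mul by blast
    then consider "subseq [t] p" | "subseq [t] w" | "subseq [t] s" by (auto simp: subseq_singleton_left)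
    \<comment> \<open>The triple records which of the three factors supplies \<open>t\<close>, so
      that one subsequence covers all cases.\<close>
    then obtain p' w' s' where sub: "subseq p' p" "subseq w' w" "subseq s' s"
      and one: "(p', w', s') \<in> {([t], [], []), ([], [t], []), ([], [], [t])}"
    proof cases
      case 1
      then show ?thesis using that[of "[t]" "[]" "[]"] by simp
    next
      case 2
      then show ?thesis using that[of "[]" "[t]" "[]"] by simp
    next
      case 3
      then show ?thesis using that[of "[]" "[]" "[t]"] by simp
    qed
    have cd': "subseq [c] u" "subseq [d] v" using assms by (auto simp: subseq_singleton_left)
    have "\<exists>l. l \<in> {[c, d], [d, c]} \<and> subseq l m"
      using m list_emb_append_mono[OF cd'] list_emb_append_mono[OF cd'(2) cd'(1)] by auto
    then obtain l where l: "l \<in> {[c, d], [d, c]}" "subseq l m" by blast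
    have "subseq (p' @ l @ w' @ [d] @ [] @ [c] @ s') L"
      unfolding L(1) by (intro list_emb_append_mono sub l cd') auto
    moreover have "distinct_adj (remdups_adj (p' @ l @ w' @ [d] @ [] @ [c] @ s'))" by simp
    moreover have "subseq (remdups_adj x) x" for x :: "'a list"
      by (induction x rule: remdups_adj.induct) auto
    ultimately have "subseq (remdups_adj (p' @ l @ w' @ [d] @ [] @ [c] @ s')) [a, b, t, a] \<or>
      subseq (remdups_adj (p' @ l @ w' @ [d] @ [] @ [c] @ s')) [a, t, b, a]"
      using class_subseqD[OF L(2)] subseq_order.trans by blast
    then show False
      using distinct cd l one by (auto simp: doubleton_eq_iff split: if_splits)
  qed
  show "gamma `` {u @ v @ w @ v @ e @ u} \<notin> down_gamma W"
    unfolding down_iff using *[of _ _ "u @ v"] by auto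
  show "gamma `` {v @ u @ w @ v @ e @ u} \<notin> down_gamma W"
    unfolding down_iff using *[of _ _ "v @ u"] by auto
qed

lemma word_identity_lhs_rhs: "word_identity W (lhs n) (rhs n)"
  unfolding word_identity_def
proof
  fix r :: "nat \<Rightarrow> 'a list"
  show "rees_class W (concat (map r (lhs n))) = rees_class W (concat (map r (rhs n)))"
  proof (cases "\<exists>c \<in> set (r 0). \<exists>d \<in> set (r 1). c \<noteq> d")
    case True
    then obtain c d where "c \<in> set (r 0)" "d \<in> set (r 1)" "c \<noteq> d" by blast
    from not_down_if_crossing[OF this set_squares_image, of "r 2" r n]
    show ?thesis by (simp add: rees_class_def lhs_def rhs_def)
  next
    case False
    have "r 0 @ r 1 = r 1 @ r 0"
    proof (cases "r 0 = [] \<or> r 1 = []")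
      case nonempty: False
      then have hd: "hd (r 0) \<in> set (r 0)" "hd (r 1) \<in> set (r 1)" by simp_all
      define c where "c = hd (r 1)"
      have "\<forall>d \<in> set (r 0). d = c" using False hd unfolding c_def by metis
      moreover have "\<forall>d \<in> set (r 1). d = c" using False hd unfolding c_def by metis
      ultimately have "r 0 = replicate (length (r 0)) c" "r 1 = replicate (length (r 1)) c"
        by (simp_all only: replicate_length_same)
      then show ?thesis by (metis append_replicate_commute)
    qed auto
    then have "concat (map r (lhs n)) = concat (map r (rhs n))"
      by (simp add: lhs_def rhs_def)
    then show ?thesis by simp
  qed
qed

section \<open>Order of letters in words equal to the left-hand side\<close>

context
  fixes n w
  assumes w: "word_identity W (lhs n) w"
begin

lemma square_letter_mem:
  assumes "i < n"
  shows "i + 3 \<in> set w"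
proof -
  define r where "r = (\<lambda>_. [])(i + 3 := [a])"
  have "concat (map r (squares n)) = [a, a]"
    using assms by (subst squares_image_single[of i]) (auto simp: r_def)
  then have img: "concat (map r (lhs n)) = [a, a]" by (simp add: lhs_def r_def)
  have cls: "[] @ [a, a] @ [b, b, t, a] \<in> \<Union> W"
    using in_classes by simp
  have "set (concat (map r w)) = {a}" using word_identity_imageD(3)[OF w img cls] by simp
  then show ?thesis by (auto simp: r_def split: if_splits)
qed

text \<open>Keeping only the two squares, as \<open>a\<close> and \<open>b\<close>, maps the
  left-hand side to a factor of a word in the first class, so the collapse \<open>[a, b]\<close> is
  forced.\<close>

lemma square_letters_order:
  assumes "i < k" "k < n"
  shows "\<not> subseq [k + 3, i + 3] w"
proof
  assume sub: "subseq [k + 3, i + 3] w"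
  define r where "r = (\<lambda>_. [])(i + 3 := [a], k + 3 := [b])"
  have "concat (map r (squares n)) = [a, a, b, b]"
    using assms by (subst squares_image_pair[of i k]) (auto simp: r_def)
  then have img: "concat (map r (lhs n)) = [a, a, b, b]" by (simp add: lhs_def r_def)
  have cls: "[] @ [a, a, b, b] @ [t, a] \<in> \<Union> W"
    using in_classes by simp
  have "remdups_adj (concat (map r w)) = [a, b]"
    using word_identity_imageD(1)[OF w img cls] distinct by simp
  moreover have "subseq [b, a] (concat (map r w))"
    using subseq_concat_map[OF sub, of r] assms by (simp add: r_def)
  ultimately have "subseq [b, a] [a, b]"
    using distinct_adj_subseq_remdups_adj[of "[b, a]" "concat (map r w)"] distinct by auto
  then show False using distinct by auto
qed

lemma y_before_squares:
  assumes "i < n"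
  shows "\<not> subseq [i + 3, 1] w"
proof
  assume sub: "subseq [i + 3, 1] w"
  define r where "r = (\<lambda>_. [])(1 := [a], i + 3 := [b])"
  have "concat (map r (squares n)) = [b, b]"
    using assms by (subst squares_image_single[of i]) (auto simp: r_def)
  then have img: "concat (map r (lhs n)) = [a, a, b, b]" by (simp add: lhs_def r_def)
  have cls: "[] @ [a, a, b, b] @ [t, a] \<in> \<Union> W"
    using in_classes by simp
  have "remdups_adj (concat (map r w)) = [a, b]"
    using word_identity_imageD(1)[OF w img cls] distinct by simp
  moreover have "subseq [b, a] (concat (map r w))"
    using subseq_concat_map[OF sub, of r] by (simp add: r_def)
  ultimately have "subseq [b, a] [a, b]"
    using distinct_adj_subseq_remdups_adj[of "[b, a]" "concat (map r w)"] distinct by auto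
  then show False using distinct by auto
qed

text \<open>Keeping only x, t and one square letter maps the left-hand side into the second class,
  so the image of \<open>w\<close> must collapse to \<open>[a, t, b, a]\<close>.\<close>

lemma x_t_square:
  assumes "i < n"
  shows "\<not> subseq [2, 0, i + 3] w" "\<not> subseq [i + 3, 2] w" "2 \<in> set w"
    and "w = u @ [i + 3] @ v \<Longrightarrow> 0 \<in> set v"
proof -
  define r where "r = (\<lambda>_. [])(0 := [a], 2 := [t], i + 3 := [b])"
  have "concat (map r (squares n)) = [b, b]"
    using assms by (subst squares_image_single[of i]) (auto simp: r_def)
  then have img: "concat (map r (lhs n)) = [a, t, b, b, a]" by (simp add: lhs_def r_def)
  have cls: "[] @ [a, t, b, b, a] @ [] \<in> \<Union> W"
    using in_classes by simp
  have rem: "remdups_adj (concat (map r w)) = [a, t, b, a]"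
    and set: "set (concat (map r w)) = {a, t, b}"
    using word_identity_imageD(1,3)[OF w img cls] distinct by auto
  have sub: "subseq (concat (map r l)) [a, t, b, a]"
    if "subseq l w" "distinct_adj (concat (map r l))" for l
    using distinct_adj_subseq_remdups_adj[OF subseq_concat_map[OF that(1)] that(2)] rem by simp
  show "\<not> subseq [2, 0, i + 3] w" using sub[of "[2, 0, i + 3]"] distinct by (auto simp: r_def)
  show "\<not> subseq [i + 3, 2] w" using sub[of "[i + 3, 2]"] distinct by (auto simp: r_def)
  show "2 \<in> set w"
  proof (rule ccontr)
    assume "2 \<notin> set w"
    then have "t \<notin> set (concat (map r w))" using distinct by (auto simp: r_def split: if_splits)
    then show False unfolding set by simp
  qed
  assume w_eq: "w = u @ [i + 3] @ v"
  show "0 \<in> set v"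
  proof (rule ccontr)
    assume "0 \<notin> set v"
    then have "a \<notin> set ([b] @ concat (map r v))"
      using distinct by (auto simp: r_def split: if_splits)
    moreover have "concat (map r w) = concat (map r u) @ [b] @ concat (map r v)"
      by (simp add: w_eq r_def)
    then have "last (concat (map r w)) \<in> set ([b] @ concat (map r v))"
      using last_append_in_set[of "[b] @ concat (map r v)" "concat (map r u)"] by (simp only:) simp
    moreover have "last (concat (map r w)) = a"
      using rem last_remdups_adj[of "concat (map r w)"] by simp
    ultimately show False by simp
  qed
qed

text \<open>The word \<open>a t a\<close> is zero in the monoid, so the position of \<open>t\<close> between two occurrences of \<open>y\<close> is
  only seen by mapping \<open>t\<close> to \<open>b\<^sup>2t\<close>.\<close>

lemma y_after_t:
  assumes "w = u @ [2] @ v"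
  shows "1 \<in> set v"
proof (rule ccontr)
  assume "1 \<notin> set v"
  define r where "r = (\<lambda>_. [])(1 :: nat := [a], 2 := [b, b, t])"
  have img: "concat (map r (lhs n)) = [a, b, b, t, a]"
    by (simp add: lhs_def r_def squares_image_Nil)
  have cls: "[] @ [a, b, b, t, a] @ [] \<in> \<Union> W"
    using in_classes by simp
  have "remdups_adj (concat (map r w)) = [a, b, t, a]"
    using word_identity_imageD(1)[OF w img cls] distinct by auto
  then have "last (concat (map r w)) = a"
    using last_remdups_adj[of "concat (map r w)"] by simp
  moreover have "concat (map r w) = concat (map r u) @ [b, b, t] @ concat (map r v)"
    by (simp add: assms r_def)
  then have "last (concat (map r w)) \<in> set ([b, b, t] @ concat (map r v))"
    using last_append_in_set[of "[b, b, t] @ concat (map r v)" "concat (map r u)"] by (simp only:) simp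
  moreover have "a \<notin> set ([b, b, t] @ concat (map r v))"
    using distinct \<open>1 \<notin> set v\<close> by (auto simp: r_def split: if_splits)
  ultimately show False by simp
qed

end

section \<open>Preservation by identities in few letters\<close>

definition proj :: "nat \<Rightarrow> 'a list" where
  "proj = (\<lambda>_. [])(0 := [a], 1 := [b])"

lemma set_proj: "set (concat (map proj w)) = (if 0 \<in> set w then {a} else {}) \<union> (if 1 \<in> set w then {b} else {})"
  by (auto simp: proj_def)

text \<open>Keeping only y turns the left-hand side into \<open>[b, b]\<close>, a factor of a word
  in the first class, and \<open>gamma\<close> preserves multiplicity. Membership in
  \<open>class_abta\<close> will need this.\<close>

lemma y_multiple:
  assumes "word_identity W (lhs n) w"
  shows "b \<in> mul (concat (map proj w))"
proof -
  define r where "r = (\<lambda>_. [])((1::nat) := [b])"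
  have img: "concat (map r (lhs n)) = [b, b]"
    by (simp add: lhs_def r_def squares_image_Nil)
  have cls: "[a] @ [b, b] @ [t, a] \<in> \<Union> W"
    using in_classes by simp
  have "mul (concat (map r w)) = mul [b, b]"
    by (rule word_identity_imageD(2)[OF assms img cls])
  moreover have "filter (\<lambda>c. c = b) (proj c) = r c" for c
    using distinct by (simp add: proj_def r_def)
  ultimately have "b \<in> mul (filter (\<lambda>c. c = b) (concat (map proj w)))"
    by (simp add: filter_concat_map mul_Cons)
  moreover have "mul (filter P v) \<subseteq> mul v" for P and v :: "'a list"
    by (induction v) (auto simp: mul_Cons)
  ultimately show ?thesis by blast
qed

text \<open>After the chosen square letter there is an x but no y. Between the letter t and the
  square letter there is a y but no x. Hence the projection of \<open>u\<close> ends in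
  \<open>b\<close> and that of \<open>v\<close> is a power of \<open>a\<close>: the new
  \<open>t\<close> falls exactly between the block of \<open>b\<close> and the last block of
  \<open>a\<close>.\<close>

lemma insert_t_in_class:
  assumes w: "word_identity W (lhs n) w" and "i < n" and w_eq: "w = u @ [i + 3] @ v"
    and xyx: "remdups_adj (concat (map proj w)) = [a, b, a]"
  shows "concat (map proj u) @ [t] @ concat (map proj v) \<in> class_abta a b t"
proof -
  have "1 \<notin> set v" using y_before_squares[OF w \<open>i < n\<close>]
    by (auto simp: w_eq subseq_singleton_left intro: list_emb_append2)
  then have set_v: "set (concat (map proj v)) = {a}"
    using x_t_square(4)[OF w \<open>i < n\<close> w_eq] set_proj[of v] by simp
  have "2 \<notin> set v" using x_t_square(2)[OF w \<open>i < n\<close>]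
    by (auto simp: w_eq subseq_singleton_left intro: list_emb_append2)
  then have "2 \<in> set u" using x_t_square(3)[OF w \<open>i < n\<close>] by (simp add: w_eq)
  then obtain u1 u2 where u: "u = u1 @ [2] @ u2" by (auto dest: split_list)
  have "0 \<notin> set u2"
  proof
    assume "0 \<in> set u2"
    then have "subseq ([] @ [2] @ [0] @ [i + 3] @ []) (u1 @ [2] @ u2 @ [i + 3] @ v)"
      by (intro list_emb_append_mono) (auto simp: subseq_singleton_left)
    then show False using x_t_square(1)[OF w \<open>i < n\<close>] by (simp add: w_eq u)
  qed
  moreover have "1 \<in> set u2"
    using y_after_t[OF w, of u1 "u2 @ [i + 3] @ v"] \<open>1 \<notin> set v\<close> by (simp add: w_eq u)
  ultimately have set_u2: "set (concat (map proj u2)) = {b}" using set_proj[of u2] by simp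
  define U where "U = concat (map proj u)"
  define V where "V = concat (map proj v)"
  have U: "U = concat (map proj u1) @ concat (map proj u2)" by (simp add: U_def u proj_def)
  have "concat (map proj u2) \<noteq> []" using set_u2 by (metis insert_not_empty list.set(1))
  then have "last U \<in> set (concat (map proj u2))"
    unfolding U by (rule last_append_in_set)
  then have "last U = b" unfolding set_u2 by simp
  have UV: "concat (map proj w) = U @ V" by (simp add: w_eq U_def V_def proj_def)
  obtain k where k: "V = replicate k a" "k \<ge> 1"
    using set_v replicate_length_same[of V a] unfolding V_def[symmetric]
    by (metis Suc_le_eq One_nat_def empty_iff insert_iff insert_not_empty length_greater_0_conv list.set(1))
  have V: "remdups_adj V = [a]" "V \<noteq> []" "hd V = a" using k by (auto simp: remdups_adj_replicate hd_replicate)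
  have "remdups_adj (U @ V) = remdups_adj U @ [a]"
    using \<open>last U = b\<close> V distinct by (subst remdups_adj_append') auto
  then have "remdups_adj U = [a, b]" using xyx UV by simp
  moreover have "remdups_adj (t # V) = [t, a]" using V(1) distinct by (auto simp: remdups_adj_Cons)
  ultimately have "remdups_adj (U @ [t] @ V) = [a, b, t, a]"
    using \<open>last U = b\<close> distinct by (subst remdups_adj_append') auto
  moreover have "mul (U @ [t] @ V) = {a, b}"
  proof -
    have "set U = set [a, b]" using \<open>remdups_adj U = [a, b]\<close> remdups_adj_set by metis
    then have setU: "set U = {a, b}" by simp
    have setV: "set V = {a}" unfolding V_def by (rule set_v)
    have "b \<notin> set V" unfolding setV using distinct by auto
    then have "b \<in> mul U"
      using y_multiple[OF w] mul_subset_set[of V] unfolding UV mul_append by blast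
    have "t \<notin> set U \<union> set V" unfolding setU setV using distinct by auto
    then have "mul (U @ [t] @ V) = mul U \<union> mul V \<union> (set U \<inter> set V)"
      by (auto simp: mul_append mul_Cons mul_Nil)
    then show ?thesis
      using \<open>b \<in> mul U\<close> mul_subset_set[of U] mul_subset_set[of V] unfolding setU setV by blast
  qed
  ultimately show ?thesis using distinct by (simp add: class_abta_iff U_def V_def)
qed

text \<open>Only the multiple letters of \<open>p\<close> are counted, so linear letters carrying a
  context can be added at no cost.\<close>

lemma few_letters_preserve:
  assumes pq: "word_identity W p q" and few: "finite (mul p)" "card (mul p) < n"
    and w: "word_identity W (lhs n) (concat (map \<sigma> p))"
    and xyx: "remdups_adj (concat (map proj (concat (map \<sigma> p)))) = [a, b, a]"
  shows "remdups_adj (concat (map proj (concat (map \<sigma> q)))) = [a, b, a]"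
proof -
  \<comment> \<open>Otherwise all n square letters come from multiple letters of \<open>p\<close>,
    and by the pigeonhole principle two of them come from the same one.\<close>
  have "\<exists>i s. i < n \<and> s \<in> set p - mul p \<and> i + 3 \<in> set (\<sigma> s)"
  proof (rule ccontr)
    assume linear: "\<not> ?thesis"
    have "\<exists>c \<in> mul p. i + 3 \<in> set (\<sigma> c)" if "i < n" for i
    proof -
      from square_letter_mem[OF w that] obtain c where "c \<in> set p" "i + 3 \<in> set (\<sigma> c)" by auto
      then show ?thesis using linear that by blast
    qed
    then obtain f where f: "f i \<in> mul p" "i + 3 \<in> set (\<sigma> (f i))" if "i < n" for i by metis
    have "f i \<noteq> f k" if ik: "i < k" "k < n" for i k
    proof
      assume eq: "f i = f k"
      define c where "c = f k"
      have c: "c \<in> mul p" "i + 3 \<in> set (\<sigma> c)" "k + 3 \<in> set (\<sigma> c)"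
        using f[of i] f[of k] ik eq by (auto simp: c_def)
      then have "c \<in> set p" using mul_subset_set[of p] by blast
      then obtain p1 p2 where p: "p = p1 @ [c] @ p2" "c \<notin> set p1"
        by (auto dest: split_list_first)
      have "c \<in> set p2"
      proof (rule ccontr)
        assume "c \<notin> set p2"
        then have "count_list p1 c = 0" "count_list p2 c = 0" using p(2) by (simp_all add: count_list_0_iff)
        then show False using c(1) by (simp add: p(1) mul_def)
      qed
      \<comment> \<open>Take \<open>k + 3\<close> from the first occurrence of \<open>c\<close> and
        \<open>i + 3\<close> from a later one: this is the forbidden order.\<close>
      then have "subseq ([] @ [k + 3] @ [i + 3]) (concat (map \<sigma> p1) @ \<sigma> c @ concat (map \<sigma> p2))"
        using c by (intro list_emb_append_mono) (auto simp: subseq_singleton_left)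
      then show False using square_letters_order[OF w ik] by (simp add: p(1))
    qed
    then have "inj_on f {..<n}" by (intro inj_onI) (metis lessThan_iff linorder_neqE_nat)
    then have "card {..<n} \<le> card (mul p)" using f few by (intro card_inj_on_le) auto
    then show False using few by simp
  qed
  then obtain i s where i: "i < n" and s: "s \<in> set p" "s \<notin> mul p" "i + 3 \<in> set (\<sigma> s)" by blast
  obtain p1 p2 where p: "p = p1 @ [s] @ p2" using s(1) by (auto dest: split_list)
  then have "s \<notin> set p1 \<union> set p2" using s(2) by (auto simp: mul_append mul_Cons)
  obtain g1 g2 where g: "\<sigma> s = g1 @ [i + 3] @ g2" using s(3) by (auto dest: split_list)
  \<comment> \<open>Substitution followed by projection, except that the chosen \<open>i + 3\<close>
    in the image of \<open>s\<close> becomes \<open>t\<close>. As \<open>s\<close> is linear in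
    \<open>p\<close>, this inserts \<open>t\<close> exactly once into the image of
    \<open>p\<close>.\<close>
  define h where "h = (\<lambda>c. concat (map proj (\<sigma> c)))(s := concat (map proj g1) @ [t] @ concat (map proj g2))"
  have "filter (\<lambda>c. c \<noteq> t) (proj c) = proj c" for c using distinct by (auto simp: proj_def)
  then have "filter (\<lambda>c. c \<noteq> t) (concat (map proj l)) = concat (map proj l)" for l
    by (simp add: filter_concat_map)
  moreover have "proj (i + 3) = []" by (simp add: proj_def)
  ultimately have filter_h: "filter (\<lambda>c. c \<noteq> t) (h c) = concat (map proj (\<sigma> c))" for c
    by (simp add: h_def g)
  have "map h p1 = map (\<lambda>c. concat (map proj (\<sigma> c))) p1" "map h p2 = map (\<lambda>c. concat (map proj (\<sigma> c))) p2"
    using \<open>s \<notin> set p1 \<union> set p2\<close> by (auto simp: h_def)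
  moreover have "h s = concat (map proj g1) @ [t] @ concat (map proj g2)" by (simp add: h_def)
  ultimately have "concat (map h p) = concat (map proj (concat (map \<sigma> p1) @ g1)) @ [t] @
      concat (map proj (g2 @ concat (map \<sigma> p2)))"
    by (simp add: p concat_map_concat_map del: map_eq_conv)
  also have "\<dots> \<in> class_abta a b t"
    by (rule insert_t_in_class[OF w i _ xyx]) (simp add: p g)
  finally have "[] @ concat (map h p) @ [] \<in> \<Union> W" by simp
  from word_identity_imageD(1)[OF pq HOL.refl this]
  have "remdups_adj (concat (map h q)) = remdups_adj (concat (map h p))" .
  \<comment> \<open>Deleting \<open>t\<close> turns \<open>h\<close> back into the projection on
    every letter, however often \<open>s\<close> occurs in \<open>q\<close>.\<close>
  from remdups_adj_filter_cong[OF this, of "\<lambda>c. c \<noteq> t"] xyx show ?thesis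
    by (simp add: filter_concat_map filter_h concat_map_concat_map)
qed

text \<open>Two new letters \<open>c\<close> and \<open>d\<close> around both sides take the context
  as their images. They occur once each, so the multiple letters still lie in
  \<open>set p\<close>.\<close>

lemma few_letters_preserve_context:
  assumes pq: "word_identity W p q" and few: "card (set p) < n"
    and w: "word_identity W (lhs n) (u @ concat (map \<sigma> p) @ v)"
    and xyx: "remdups_adj (concat (map proj (u @ concat (map \<sigma> p) @ v))) = [a, b, a]"
  shows "remdups_adj (concat (map proj (u @ concat (map \<sigma> q) @ v))) = [a, b, a]"
proof -
  obtain c where c: "c \<notin> set p \<union> set q"
    using ex_new_if_finite[OF infinite_UNIV_nat, of "set p \<union> set q"] by auto
  obtain d where d: "d \<notin> set p \<union> set q \<union> {c}"
    using ex_new_if_finite[OF infinite_UNIV_nat, of "set p \<union> set q \<union> {c}"] by auto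
  define \<tau> where "\<tau> = \<sigma>(c := u, d := v)"
  have \<tau>: "concat (map \<tau> ([c] @ l @ [d])) = u @ concat (map \<sigma> l) @ v" if "set l \<subseteq> set p \<union> set q" for l
  proof -
    have "map \<tau> l = map \<sigma> l" using that c d by (auto simp: \<tau>_def)
    moreover have "\<tau> c = u" "\<tau> d = v" using d by (auto simp: \<tau>_def)
    ultimately show ?thesis by (simp del: map_eq_conv)
  qed
  have "mul ([c] @ p @ [d]) \<subseteq> set p"
    using c d mul_subset_set[of p] by (auto simp: mul_append mul_Cons mul_Nil)
  then have "finite (mul ([c] @ p @ [d]))" "card (mul ([c] @ p @ [d])) < n"
    using few by (auto intro: finite_subset le_less_trans[OF card_mono])
  from few_letters_preserve[OF word_identity_context[OF pq] this, of \<tau>] w xyx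
  show ?thesis by (simp only: \<tau> Un_upper1 Un_upper2)
qed

lemma not_finitely_based: "\<not> finitely_based (M_gamma W)"
proof
  assume "finitely_based (M_gamma W)"
  then obtain E where E: "finite E" "E \<subseteq> identities (M_gamma W)"
    and complete: "\<And>p q. (p, q) \<in> identities (M_gamma W) \<Longrightarrow> deducible E p q"
    unfolding finitely_based_def by blast
  define f where "f = (\<lambda>(p, q). card (set (mterm_word p)) + card (set (mterm_word q)))"
  \<comment> \<open>The \<open>0\<close> keeps \<open>Max\<close> meaningful when \<open>E\<close>
    is empty. Both sides are bounded because axioms are applied in both directions.\<close>
  define n where "n = Suc (Max (insert 0 (f ` E)))"
  have few: "card (set (mterm_word p)) < n" "card (set (mterm_word q)) < n" if "(p, q) \<in> E" for p q
  proof -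
    have "f (p, q) \<le> Max (insert 0 (f ` E))" using E(1) that by (intro Max_ge) auto
    then show "card (set (mterm_word p)) < n" "card (set (mterm_word q)) < n"
      by (auto simp: n_def f_def)
  qed
  \<comment> \<open>The first conjunct supplies the order constraints at every step of a deduction;
    the second is what separates \<open>lhs n\<close> from \<open>rhs n\<close>.\<close>
  define J where "J w \<longleftrightarrow> word_identity W (lhs n) w \<and> remdups_adj (concat (map proj w)) = [a, b, a]" for w
  have step: "J (u @ concat (map \<sigma> q) @ v)"
    if "word_identity W p q" "card (set p) < n" "J (u @ concat (map \<sigma> p) @ v)" for p q \<sigma> u v
    using that few_letters_preserve_context[OF that(1,2)]
      word_identity_trans[OF _ word_identity_context[OF word_identity_subst[OF that(1)]]]
    unfolding J_def by blast
  have invariant: "J (u @ concat (map \<sigma> (mterm_word p)) @ v) = J (u @ concat (map \<sigma> (mterm_word q)) @ v)"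
    if "(p, q) \<in> E" for p q \<sigma> u v
  proof -
    have "word_identity W (mterm_word p) (mterm_word q)" using E(2) that identities_iff by blast
    then show ?thesis using step few[OF that] word_identity_sym by blast
  qed
  obtain p q where pq: "mterm_word p = lhs n" "mterm_word q = rhs n" using ex_mterm_word by metis
  then have "(p, q) \<in> identities (M_gamma W)" by (simp add: identities_iff word_identity_lhs_rhs)
  from deducible_invariant[OF complete[OF this], of J "[]" "\<lambda>x. [x]" "[]"] invariant
  have "J (lhs n) = J (rhs n)" by (simp add: pq)
  moreover have "concat (map proj (lhs n)) = [a, b, b, a]" "concat (map proj (rhs n)) = [b, a, b, a]"
    by (simp_all add: lhs_def rhs_def proj_def squares_image_Nil)
  then have "J (lhs n)" "\<not> J (rhs n)"
    using distinct by (auto simp: J_def word_identity_def)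
  ultimately show False by simp
qed

end

theorem corollary5p4:
  fixes a b t :: 'a
  assumes "countable (UNIV :: 'a set)" and "infinite (UNIV :: 'a set)"
    and "distinct [a, b, t]"
  shows "\<not> finitely_based (M_gamma {class_abta a b t, class_atba a b t})"
proof -
  interpret three_letters a b t by standard (rule assms(3))
  show ?thesis by (rule not_finitely_based)
qed

end
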